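(* Let $(X,L)$ be a regular convergence space such that Bob has a winning strategy in $\mathsf G_{\mathrm{fin}}(\mathcal C_L,\operatorname{Cov}(X))$. If $\mathcal W$ is a cover of $X$ by $G_\delta$-subsets of $(X,\tau_L)$ and every $L$-compactoid subset of $X$ is contained in some member of $\mathcal W$, then $\mathcal W$ has a countable subcover.
   Context: All filters are proper. $\operatorname{Fil}(X)$ is the set of filters on $X$, and $\dot x=\{A\subseteq X:x\in A\}$. A convergence on $X$ is a function $L:\operatorname{Fil}(X)\to\mathcal P(X)$ such that $x\in L(\dot x)$ for every $x\in X$, and $L(\mathcal F)\subseteq L(\mathcal G)$ whenever $\mathcal F\subseteq\mathcal G$; then $(X,L)$ is a convergence space. Write $\mathcal F\to_L x$ for $x\in L(\mathcal F)$. The topology $\tau_L$ (topological modification) consists of all $O\subseteq X$ such that $O\in\mathcal F$ whenever $x\in O$ and $\mathcal F\to_L x$. For a filter $\mathcal F$ and a set $A$, $\mathcal F\mathrel{\#}A$ means $F\cap A\neq\varnothing$ for every $F\in\mathcal F$. Put $\operatorname{cl}_LA=\{x\in X:\mathcal F\to_Lx\text{ for some }\mathcal F\mathrel{\#}A\}$. $L$ is regular if $\mathcal F\to_L x$ implies that the filter generated by $\{\operatorname{cl}_LF:F\in\mathcal F\}$ also converges to $x$. A set $K\subseteq X$ is $L$-compactoid if every ultrafilter $\mathfrak p$ on $X$ with $K\in\mathfrak p$ satisfies $L(\mathfrak p)\neq\varnothing$. A family $\mathcal U\subseteq\mathcal P(X)$ is an $L$-cover if $\mathcal U\cap\mathcal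 F\neq\varnothing$ for every $\mathcal F\in\operatorname{Fil}(X)$ with $L(\mathcal F)\neq\varnothing$; $\mathcal C_L$ is the family of all $L$-covers. $\operatorname{Cov}(X)$ is the family of all covers of $X$ by subsets of $X$. In the game $\mathsf G_{\mathrm{fin}}(\mathcal A,\mathcal B)$, in each inning $n<\omega$ Alice chooses $\mathcal U_n\in\mathcal A$ and then Bob chooses a finite subfamily $\mathcal V_n\subseteq\mathcal U_n$; Bob wins if $\bigcup_{n<\omega}\mathcal V_n\in\mathcal B$, otherwise Alice wins. *)

theory Defs
  imports "HOL-Analysis.Analysis"
begin

text \<open>
  Spaces have an explicit carrier set \<open>X\<close>, which may be empty. A filter on \<open>X\<close> is represented by
  the library filter on the ambient type that it generates; \<open>A\<close> belongs to \<open>F\<close> iff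
  \<open>\<forall>\<^sub>F y in F. y \<in> A\<close>, and in particular \<open>X\<close> belongs to \<open>F\<close> iff \<open>F \<le> principal X\<close>.
  The library type contains the improper filter \<open>bot\<close>, which is excluded here, and its order is the
  reverse of inclusion: \<open>G \<le> F\<close> iff every member of \<open>F\<close> is a member of \<open>G\<close>. The principal filter
  at a point \<open>x\<close> is \<open>principal {x}\<close>.
\<close>

definition filters_on :: "'a set \<Rightarrow> 'a filter set" where
  "filters_on X = {F. F \<noteq> bot \<and> F \<le> principal X}"

definition ultrafilters_on :: "'a set \<Rightarrow> 'a filter set" where
  "ultrafilters_on X = {p \<in> filters_on X. \<forall>G \<in> filters_on X. G \<le> p \<longrightarrow> G = p}"

text \<open>The values of \<open>L\<close> outside \<open>filters_on X\<close> are irrelevant throughout.\<close>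

definition convergence_space :: "'a set \<Rightarrow> ('a filter \<Rightarrow> 'a set) \<Rightarrow> bool" where
  "convergence_space X L \<longleftrightarrow>
     (\<forall>F \<in> filters_on X. L F \<subseteq> X) \<and>
     (\<forall>x \<in> X. x \<in> L (principal {x})) \<and>
     (\<forall>F \<in> filters_on X. \<forall>G \<in> filters_on X. G \<le> F \<longrightarrow> L F \<subseteq> L G)"

definition conv_open :: "'a set \<Rightarrow> ('a filter \<Rightarrow> 'a set) \<Rightarrow> 'a set \<Rightarrow> bool" where
  "conv_open X L U \<longleftrightarrow>
     U \<subseteq> X \<and> (\<forall>x \<in> U. \<forall>F \<in> filters_on X. x \<in> L F \<longrightarrow> (\<forall>\<^sub>F y in F. y \<in> U))"

definition top_modification :: "'a set \<Rightarrow> ('a filter \<Rightarrow> 'a set) \<Rightarrow> 'a topology" where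
  "top_modification X L = topology (conv_open X L)"

lemma istopology_conv_open: "istopology (conv_open X L)"
  unfolding istopology_def
proof (intro conjI allI impI)
  fix S T assume "conv_open X L S" "conv_open X L T"
  then show "conv_open X L (S \<inter> T)"
    unfolding conv_open_def by (auto intro: eventually_conj)
next
  fix K assume K: "\<forall>S\<in>K. conv_open X L S"
  show "conv_open X L (\<Union>K)"
    unfolding conv_open_def
  proof (intro conjI ballI impI)
    show "\<Union>K \<subseteq> X" using K by (auto simp: conv_open_def)
  next
    fix x F assume "x \<in> \<Union>K" and F: "F \<in> filters_on X" "x \<in> L F"
    then obtain S where S: "S \<in> K" "x \<in> S" by blast
    with K F have "\<forall>\<^sub>F y in F. y \<in> S" by (auto simp: conv_open_def)
    then show "\<forall>\<^sub>F y in F. y \<in> \<Union>K"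
      by (rule eventually_mono) (use S in blast)
  qed
qed

lemma openin_top_modification: "openin (top_modification X L) U \<longleftrightarrow> conv_open X L U"
  by (simp add: top_modification_def istopology_conv_open topology_inverse')

lemma topspace_top_modification: "topspace (top_modification X L) = X"
proof -
  have "conv_open X L X"
    by (auto simp: conv_open_def filters_on_def le_principal)
  then show ?thesis
    unfolding topspace_def openin_top_modification by (auto simp: conv_open_def)
qed

definition filter_meshes :: "'a filter \<Rightarrow> 'a set \<Rightarrow> bool" where
  "filter_meshes F A \<longleftrightarrow> (\<forall>B. (\<forall>\<^sub>F y in F. y \<in> B) \<longrightarrow> B \<inter> A \<noteq> {})"

definition conv_closure :: "'a set \<Rightarrow> ('a filter \<Rightarrow> 'a set) \<Rightarrow> 'a set \<Rightarrow> 'a set" where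
  "conv_closure X L A = {x \<in> X. \<exists>F \<in> filters_on X. filter_meshes F A \<and> x \<in> L F}"

text \<open>The infimum of principal filters below is the filter generated by the closures of the
  members of \<open>F\<close>.\<close>

definition closure_filter :: "'a set \<Rightarrow> ('a filter \<Rightarrow> 'a set) \<Rightarrow> 'a filter \<Rightarrow> 'a filter" where
  "closure_filter X L F =
     (INF A \<in> {A. A \<subseteq> X \<and> (\<forall>\<^sub>F y in F. y \<in> A)}. principal (conv_closure X L A))"

definition regular_convergence :: "'a set \<Rightarrow> ('a filter \<Rightarrow> 'a set) \<Rightarrow> bool" where
  "regular_convergence X L \<longleftrightarrow>
     (\<forall>F \<in> filters_on X. \<forall>x. x \<in> L F \<longrightarrow> x \<in> L (closure_filter X L F))"

definition compactoid :: "'a set \<Rightarrow> ('a filter \<Rightarrow> 'a set) \<Rightarrow> 'a set \<Rightarrow> bool" where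
  "compactoid X L K \<longleftrightarrow>
     K \<subseteq> X \<and> (\<forall>p \<in> ultrafilters_on X. (\<forall>\<^sub>F y in p. y \<in> K) \<longrightarrow> L p \<noteq> {})"

definition conv_covers :: "'a set \<Rightarrow> ('a filter \<Rightarrow> 'a set) \<Rightarrow> 'a set set set" where
  "conv_covers X L =
     {\<U>. \<U> \<subseteq> Pow X \<and> (\<forall>F \<in> filters_on X. L F \<noteq> {} \<longrightarrow> (\<exists>U \<in> \<U>. \<forall>\<^sub>F y in F. y \<in> U))}"

definition set_covers :: "'a set \<Rightarrow> 'a set set set" where
  "set_covers X = {\<U>. \<U> \<subseteq> Pow X \<and> \<Union>\<U> = X}"

text \<open>A strategy for Bob in the game \<open>G\<^sub>f\<^sub>i\<^sub>n(\<A>, \<B>)\<close> maps the nonempty list of the moves Alice has made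
  so far, the current inning included, to Bob's answer. It is winning if along every play in which
  Alice moves legally, all its answers are legal and Bob wins.\<close>

definition gfin_winning_strategy ::
    "'b set set \<Rightarrow> 'b set set \<Rightarrow> ('b set list \<Rightarrow> 'b set) \<Rightarrow> bool" where
  "gfin_winning_strategy \<A> \<B> \<sigma> \<longleftrightarrow>
     (\<forall>\<U> :: nat \<Rightarrow> 'b set. (\<forall>n. \<U> n \<in> \<A>) \<longrightarrow>
        (\<forall>n. finite (\<sigma> (map \<U> [0..<Suc n])) \<and> \<sigma> (map \<U> [0..<Suc n]) \<subseteq> \<U> n) \<and>
        (\<Union>n. \<sigma> (map \<U> [0..<Suc n])) \<in> \<B>)"

definition bob_wins_gfin :: "'b set set \<Rightarrow> 'b set set \<Rightarrow> bool" where
  "bob_wins_gfin \<A> \<B> \<longleftrightarrow> (\<exists>\<sigma>. gfin_winning_strategy \<A> \<B> \<sigma>)"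

end

theory Submission
  imports Defs
begin

text \<open>
  Fix a winning strategy \<open>\<sigma>\<close> for Bob. For a position \<open>s\<close> of the game let \<open>K\<^sub>s\<close> be the intersection, over
  all \<open>L\<close>-covers \<open>U\<close>, of the closures of \<open>\<Union>\<sigma>(s, U)\<close>. It is compactoid: if an ultrafilter \<open>p\<close> does not
  converge then, by regularity, the sets whose closure is not in \<open>p\<close> form an \<open>L\<close>-cover, and Bob's
  answer to this cover shows \<open>K\<^sub>s \<notin> p\<close>. Hence \<open>K\<^sub>s \<subseteq> W\<close> for some \<open>W \<in> \<W>\<close>. If \<open>W \<subseteq> O\<close> with \<open>O\<close> open, then
  \<open>O\<close> together with the complements of the sets \<open>\<Union>\<sigma>(s, U)\<close> is an \<open>L\<close>-cover, and every \<open>L\<close>-cover has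
  a countable subcover, as seen by letting Alice repeat it. As \<open>W\<close> is a \<open>G\<^sub>\<delta>\<close>, countably many \<open>U\<close>
  already satisfy \<open>\<Inter>\<^sub>U \<Union>\<sigma>(s, U) \<subseteq> W\<close>. Playing only these \<open>U\<close> gives a countable tree of positions. A
  point outside all the sets \<open>W\<close> chosen along the tree would be missed by Bob along some branch.
\<close>

section \<open>Ultrafilters, closures and compactoid sets\<close>

lemma ultrafilters_on_not_eventually:
  assumes p: "p \<in> ultrafilters_on X" and "\<not> (\<forall>\<^sub>F y in p. y \<in> A)"
  shows "\<forall>\<^sub>F y in p. y \<notin> A"
proof -
  \<comment> \<open>The trace of \<open>p\<close> on the complement of \<open>A\<close> is proper
    because \<open>A\<close> is not in \<open>p\<close>; minimality of \<open>p\<close> in the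
    filter order then makes the two equal.\<close>
  let ?q = "inf p (principal (- A))"
  have "?q \<noteq> bot"
    using assms(2) by (simp add: trivial_limit_def eventually_inf_principal)
  moreover have "?q \<le> principal X"
    using p by (auto simp: ultrafilters_on_def filters_on_def intro: le_infI1)
  ultimately have "?q = p"
    using p by (auto simp: ultrafilters_on_def filters_on_def)
  then have "p \<le> principal (- A)"
    by (metis inf_le2)
  then show ?thesis
    by (simp add: le_principal)
qed

lemma filter_meshes_Un:
  "filter_meshes F (A \<union> B) \<longleftrightarrow> filter_meshes F A \<or> filter_meshes F B"
proof
  assume AB: "filter_meshes F (A \<union> B)"
  show "filter_meshes F A \<or> filter_meshes F B"
  proof (rule ccontr)
    assume "\<not> ?thesis"
    then obtain C D where C: "\<forall>\<^sub>F y in F. y \<in> C" "C \<inter> A = {}" and D: "\<forall>\<^sub>F y in F. y \<in> D" "D \<inter> B = {}"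
      by (auto simp: filter_meshes_def)
    have "\<forall>\<^sub>F y in F. y \<in> C \<inter> D"
      using C D by (auto intro: eventually_conj)
    with AB have "(C \<inter> D) \<inter> (A \<union> B) \<noteq> {}"
      unfolding filter_meshes_def by blast
    with C D show False by blast
  qed
next
  assume "filter_meshes F A \<or> filter_meshes F B"
  then show "filter_meshes F (A \<union> B)"
    unfolding filter_meshes_def by blast
qed

lemma conv_closure_Un:
  "conv_closure X L (A \<union> B) = conv_closure X L A \<union> conv_closure X L B"
  by (auto simp: conv_closure_def filter_meshes_Un)

lemma conv_closure_empty:
  fixes X :: "'a set"
  shows "conv_closure X L {} = {}"
proof -
  have "\<not> filter_meshes F {}" for F :: "'a filter"
    unfolding filter_meshes_def by (simp add: exI[of _ UNIV])
  then show ?thesis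
    by (simp add: conv_closure_def)
qed

lemma conv_closure_Union:
  "finite \<A> \<Longrightarrow> conv_closure X L (\<Union>\<A>) = (\<Union>A\<in>\<A>. conv_closure X L A)"
  by (induction \<A> rule: finite_induct) (simp_all add: conv_closure_empty conv_closure_Un)

lemma conv_closure_subset: "conv_closure X L A \<subseteq> X"
  by (auto simp: conv_closure_def)

lemma eventually_disjoint_if_notin_conv_closure:
  assumes "F \<in> filters_on X" "x \<in> L F" "x \<in> X" "x \<notin> conv_closure X L A"
  shows "\<forall>\<^sub>F y in F. y \<in> X - A"
proof -
  have "\<not> filter_meshes F A"
    using assms by (auto simp: conv_closure_def)
  then obtain B where B: "\<forall>\<^sub>F y in F. y \<in> B" "B \<inter> A = {}"
    by (auto simp: filter_meshes_def)
  have "\<forall>\<^sub>F y in F. y \<in> X"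
    using assms(1) by (simp add: filters_on_def le_principal)
  with B(1) have "\<forall>\<^sub>F y in F. y \<in> B \<and> y \<in> X"
    by (rule eventually_conj)
  then show ?thesis
    by (rule eventually_mono) (use B(2) in blast)
qed

text \<open>If no member of a convergent filter \<open>F\<close> lay in this family,
  \<open>p\<close> would contain the closures of all members of \<open>F\<close>. Then
  \<open>p\<close> would refine the closure filter, which by regularity keeps the limits of
  \<open>F\<close>, so \<open>p\<close> would converge.\<close>

lemma conv_covers_small_closures:
  assumes cs: "convergence_space X L" and reg: "regular_convergence X L"
    and p: "p \<in> filters_on X" "L p = {}"
  shows "{A. A \<subseteq> X \<and> \<not> (\<forall>\<^sub>F y in p. y \<in> conv_closure X L A)} \<in> conv_covers X L"
proof -
  have "\<exists>A. A \<subseteq> X \<and> \<not> (\<forall>\<^sub>F y in p. y \<in> conv_closure X L A) \<and> (\<forall>\<^sub>F y in F. y \<in> A)"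
    if F: "F \<in> filters_on X" "L F \<noteq> {}" for F
  proof (rule ccontr)
    assume "\<not> ?thesis"
    then have le: "p \<le> closure_filter X L F"
      by (auto simp: closure_filter_def le_INF_iff le_principal)
    \<comment> \<open>The member \<open>X\<close> of \<open>F\<close> puts the closure filter on
      \<open>X\<close>; it is proper since the proper filter \<open>p\<close> refines it.\<close>
    have "\<forall>\<^sub>F y in F. y \<in> X"
      using F(1) by (simp add: filters_on_def le_principal)
    then have "closure_filter X L F \<le> principal (conv_closure X L X)"
      unfolding closure_filter_def by (intro INF_lower) auto
    also have "\<dots> \<le> principal X"
      by (simp add: conv_closure_subset)
    finally have cf: "closure_filter X L F \<in> filters_on X"
      using le p(1) by (auto simp: filters_on_def bot_unique)
    obtain x where "x \<in> L F"
      using F(2) by blast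
    with F(1) reg have "x \<in> L (closure_filter X L F)"
      by (auto simp: regular_convergence_def)
    moreover have "L (closure_filter X L F) \<subseteq> L p"
      using cs cf p(1) le unfolding convergence_space_def by blast
    ultimately show False
      using p(2) by blast
  qed
  then show ?thesis
    unfolding conv_covers_def by blast
qed

text \<open>With the family of \<open>L\<close>-covers nonempty, intersections of closures indexed
  by it stay inside \<open>X\<close>.\<close>

lemma Pow_in_conv_covers: "Pow X \<in> conv_covers X L"
  by (auto simp: conv_covers_def filters_on_def le_principal)

lemma compactoid_INT_closure_finite_selection:
  assumes cs: "convergence_space X L" and reg: "regular_convergence X L"
    and f: "\<And>\<U>. \<U> \<in> conv_covers X L \<Longrightarrow> finite (f \<U>) \<and> f \<U> \<subseteq> \<U>"
  shows "compactoid X L (\<Inter>\<U>\<in>conv_covers X L. conv_closure X L (\<Union>(f \<U>)))" (is "compactoid X L ?K")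
  unfolding compactoid_def
proof (intro conjI ballI impI notI)
  show "?K \<subseteq> X"
    using Pow_in_conv_covers[of X L] conv_closure_subset[of X L] by blast
next
  fix p assume p: "p \<in> ultrafilters_on X" and K: "\<forall>\<^sub>F y in p. y \<in> ?K" and "L p = {}"
  let ?U = "{A. A \<subseteq> X \<and> \<not> (\<forall>\<^sub>F y in p. y \<in> conv_closure X L A)}"
  have pf: "p \<in> filters_on X"
    using p by (simp add: ultrafilters_on_def)
  have U: "?U \<in> conv_covers X L"
    using conv_covers_small_closures[OF cs reg pf \<open>L p = {}\<close>] .
  have fin: "finite (f ?U)" and sub: "f ?U \<subseteq> ?U"
    using f[OF U] by auto
  \<comment> \<open>Finiteness of \<open>f ?U\<close> serves twice: finitely many complements in
    \<open>p\<close> meet in a member of \<open>p\<close>, and closure commutes with finite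
    unions.\<close>
  have "\<forall>\<^sub>F y in p. \<forall>A\<in>f ?U. y \<notin> conv_closure X L A"
    using fin sub by (intro eventually_ball_finite ballI ultrafilters_on_not_eventually[OF p]) auto
  then have "\<forall>\<^sub>F y in p. y \<notin> conv_closure X L (\<Union>(f ?U))"
    by (rule eventually_mono) (simp add: conv_closure_Union[OF fin])
  moreover have "\<forall>\<^sub>F y in p. y \<in> conv_closure X L (\<Union>(f ?U))"
    using K by (rule eventually_mono) (use U in blast)
  ultimately have "\<forall>\<^sub>F y in p. False"
    by (rule eventually_elim2) blast
  with pf show False
    by (simp add: filters_on_def trivial_limit_def)
qed

section \<open>Strategies and countable subcovers\<close>

lemma gfin_winning_strategy_legal:
  assumes \<sigma>: "gfin_winning_strategy \<A> \<B> \<sigma>" and s: "set s \<subseteq> \<A>" and U: "U \<in> \<A>"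
  shows "finite (\<sigma> (s @ [U])) \<and> \<sigma> (s @ [U]) \<subseteq> U"
proof -
  \<comment> \<open>Winning is defined through infinite plays only, so the finite position is
    prolonged by repeating \<open>U\<close> forever.\<close>
  define \<U> where "\<U> n = (if n < length s then s ! n else U)" for n
  have "map \<U> [0..<length s] = s"
    by (auto simp: \<U>_def intro: nth_equalityI)
  then have "map \<U> [0..<Suc (length s)] = s @ [U]"
    by (simp add: \<U>_def)
  moreover have "\<forall>n. \<U> n \<in> \<A>"
    using s U by (auto simp: \<U>_def)
  then have "finite (\<sigma> (map \<U> [0..<Suc (length s)]))"
      "\<sigma> (map \<U> [0..<Suc (length s)]) \<subseteq> \<U> (length s)"
    using \<sigma> unfolding gfin_winning_strategy_def by blast+
  ultimately show ?thesis
    by (simp add: \<U>_def)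
qed

lemma gfin_winning_strategy_countable_subcover:
  assumes \<sigma>: "gfin_winning_strategy \<A> (set_covers X) \<sigma>" and U: "U \<in> \<A>"
  obtains V where "V \<subseteq> U" "countable V" "\<Union>V = X"
proof
  let ?V = "\<Union>n. \<sigma> (map (\<lambda>_. U) [0..<Suc n])"
  note play = \<sigma>[unfolded gfin_winning_strategy_def, THEN spec, of "\<lambda>_. U", simplified U, simplified]
  have *: "finite (\<sigma> (map (\<lambda>_. U) [0..<Suc n])) \<and> \<sigma> (map (\<lambda>_. U) [0..<Suc n]) \<subseteq> U" for n
    using play by simp
  show "?V \<subseteq> U"
    using * by blast
  show "countable ?V"
    using * by (intro countable_UN) (simp_all add: countable_finite)
  have "?V \<in> set_covers X"
    using play by simp
  then show "\<Union>?V = X"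
    by (simp add: set_covers_def)
qed

lemma countable_INT_subset_open:
  assumes cs: "convergence_space X L"
    and \<sigma>: "gfin_winning_strategy (conv_covers X L) (set_covers X) \<sigma>"
    and Q: "openin (top_modification X L) Q"
    and K: "(\<Inter>\<U>\<in>conv_covers X L. conv_closure X L (f \<U>)) \<subseteq> Q"
  obtains C where "C \<subseteq> conv_covers X L" "countable C" "X \<inter> (\<Inter>\<U>\<in>C. f \<U>) \<subseteq> Q"
proof -
  have co: "conv_open X L Q"
    using Q by (simp add: openin_top_modification)
  \<comment> \<open>A filter converging to a point of \<open>Q\<close> contains the open set
    \<open>Q\<close>. A limit outside \<open>Q\<close> is outside some closure, so the filter
    contains the complement of that \<open>f \<U>\<close>.\<close>
  let ?G = "insert Q ((\<lambda>\<U>. X - f \<U>) ` conv_covers X L)"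
  have "\<exists>U\<in>?G. \<forall>\<^sub>F y in F. y \<in> U" if F: "F \<in> filters_on X" "L F \<noteq> {}" for F
  proof -
    have "L F \<subseteq> X"
      using F(1) cs by (simp add: convergence_space_def)
    with F(2) obtain x where x: "x \<in> L F" "x \<in> X"
      by blast
    show ?thesis
    proof (cases "x \<in> Q")
      case True
      then show ?thesis
        using co F x unfolding conv_open_def by blast
    next
      case False
      then obtain \<U> where "\<U> \<in> conv_covers X L" "x \<notin> conv_closure X L (f \<U>)"
        using K by blast
      then show ?thesis
        using eventually_disjoint_if_notin_conv_closure[where L = L, OF F(1) x] by blast
    qed
  qed
  moreover have "?G \<subseteq> Pow X"
    using co by (auto simp: conv_open_def)
  ultimately have "?G \<in> conv_covers X L"
    by (simp add: conv_covers_def)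
  then obtain V where V: "V \<subseteq> ?G" "countable V" "\<Union>V = X"
    using gfin_winning_strategy_countable_subcover[OF \<sigma>] by metis
  \<comment> \<open>Apart from \<open>Q\<close>, the subcover consists of complements indexed by a
    countable \<open>C\<close>. If \<open>C\<close> is empty, the indexed intersection is
    \<open>UNIV\<close>, hence the \<open>X \<inter>\<close> in the conclusion.\<close>
  have "V - {Q} \<subseteq> (\<lambda>\<U>. X - f \<U>) ` conv_covers X L"
    using V(1) by blast
  moreover have "countable (V - {Q})"
    using V(2) by blast
  ultimately obtain C where C: "countable C" "C \<subseteq> conv_covers X L" "V - {Q} = (\<lambda>\<U>. X - f \<U>) ` C"
    using countable_subset_image by metis
  have "X \<inter> (\<Inter>\<U>\<in>C. f \<U>) \<subseteq> Q"
  proof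
    fix x assume x: "x \<in> X \<inter> (\<Inter>\<U>\<in>C. f \<U>)"
    then obtain A where A: "A \<in> V" "x \<in> A"
      using V(3) by blast
    then have "A \<notin> V - {Q}"
      using x unfolding C(3) by blast
    with A show "x \<in> Q" by blast
  qed
  with C that show thesis by blast
qed

lemma countable_INT_subset_gdelta:
  assumes cs: "convergence_space X L"
    and \<sigma>: "gfin_winning_strategy (conv_covers X L) (set_covers X) \<sigma>"
    and W: "gdelta_in (top_modification X L) W"
    and K: "(\<Inter>\<U>\<in>conv_covers X L. conv_closure X L (f \<U>)) \<subseteq> W"
  obtains C where "C \<subseteq> conv_covers X L" "countable C" "X \<inter> (\<Inter>\<U>\<in>C. f \<U>) \<subseteq> W"
proof -
  \<comment> \<open>Each \<open>G n\<close> contributes a countable family of covers; the union of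
    these families handles all \<open>n\<close> at once.\<close>
  obtain G :: "nat \<Rightarrow> 'a set" where G: "\<And>n. openin (top_modification X L) (G n)" "\<Inter>(range G) = W"
    using W by (auto simp: gdelta_in_descending)
  have "\<exists>C. C \<subseteq> conv_covers X L \<and> countable C \<and> X \<inter> (\<Inter>\<U>\<in>C. f \<U>) \<subseteq> G n" for n
  proof -
    have "(\<Inter>\<U>\<in>conv_covers X L. conv_closure X L (f \<U>)) \<subseteq> G n"
      using K G(2) by blast
    from countable_INT_subset_open[OF cs \<sigma> G(1) this] show ?thesis
      by metis
  qed
  then obtain C where C: "\<And>n. C n \<subseteq> conv_covers X L" "\<And>n. countable (C n)"
      "\<And>n. X \<inter> (\<Inter>\<U>\<in>C n. f \<U>) \<subseteq> G n"
    by metis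
  show thesis
  proof
    show "(\<Union>n. C n) \<subseteq> conv_covers X L" "countable (\<Union>n. C n)"
      using C by auto
    show "X \<inter> (\<Inter>\<U>\<in>(\<Union>n. C n). f \<U>) \<subseteq> W"
      using C(3) unfolding G(2)[symmetric] by blast
  qed
qed

section \<open>The countable tree of positions\<close>

lemma gfin_winning_strategy_countable_tree:
  assumes \<sigma>: "gfin_winning_strategy \<A> (set_covers X) \<sigma>"
    and step: "\<And>s. set s \<subseteq> \<A> \<Longrightarrow>
      \<exists>W\<in>\<W>. \<exists>C\<subseteq>\<A>. C \<noteq> {} \<and> countable C \<and> X \<inter> (\<Inter>U\<in>C. \<Union>(\<sigma> (s @ [U]))) \<subseteq> W"
  obtains \<V> where "\<V> \<subseteq> \<W>" "countable \<V>" "X \<subseteq> \<Union>\<V>"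
proof -
  \<comment> \<open>Legality of \<open>s\<close> is a premise under the quantifiers, so that choice
    yields total functions \<open>W\<close> and \<open>g\<close>, arbitrary at illegal
    positions.\<close>
  have "\<exists>W g. set s \<subseteq> \<A> \<longrightarrow>
      W \<in> \<W> \<and> (\<forall>k::nat. g k \<in> \<A>) \<and> X \<inter> (\<Inter>k. \<Union>(\<sigma> (s @ [g k]))) \<subseteq> W" for s
  proof (cases "set s \<subseteq> \<A>")
    case True
    then obtain W C where W: "W \<in> \<W>" and C: "C \<subseteq> \<A>" "C \<noteq> {}" "countable C"
      and sub: "X \<inter> (\<Inter>U\<in>C. \<Union>(\<sigma> (s @ [U]))) \<subseteq> W"
      using step by metis
    \<comment> \<open>The enumeration may repeat members, so finite \<open>C\<close> is allowed, but
      \<open>C\<close> must be nonempty.\<close>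
    have rng: "range (from_nat_into C) = C"
      using C by (simp add: range_from_nat_into)
    have "(\<Inter>k. \<Union>(\<sigma> (s @ [from_nat_into C k]))) \<subseteq> (\<Inter>U\<in>C. \<Union>(\<sigma> (s @ [U])))"
    proof (rule INT_greatest)
      fix U assume "U \<in> C"
      then obtain k where "U = from_nat_into C k"
        using rng by blast
      then show "(\<Inter>k. \<Union>(\<sigma> (s @ [from_nat_into C k]))) \<subseteq> \<Union>(\<sigma> (s @ [U]))"
        by blast
    qed
    with sub have "X \<inter> (\<Inter>k. \<Union>(\<sigma> (s @ [from_nat_into C k]))) \<subseteq> W"
      by blast
    moreover have "\<forall>k. from_nat_into C k \<in> \<A>"
      using C by (auto intro: from_nat_into)
    ultimately show ?thesis
      using W by (intro exI[of _ W] exI[of _ "from_nat_into C"]) simp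
  qed auto
  then obtain W g where Wg: "\<And>s. set s \<subseteq> \<A> \<Longrightarrow> W s \<in> \<W>"
      "\<And>s k::nat. set s \<subseteq> \<A> \<Longrightarrow> g s k \<in> \<A>"
      "\<And>s. set s \<subseteq> \<A> \<Longrightarrow> X \<inter> (\<Inter>k. \<Union>(\<sigma> (s @ [g s k]))) \<subseteq> W s"
    by metis
  \<comment> \<open>A list of naturals codes a node of the tree, its head being the index of the
    last move; thus \<open>T\<close> is countable.\<close>
  define T where "T = range (\<lambda>r. foldr (\<lambda>k s. s @ [g s k]) r [])"
  have T_Nil: "[] \<in> T"
    unfolding T_def by (rule range_eqI[of _ _ "[]"]) simp
  have T_snoc: "s @ [g s k] \<in> T" if s: "s \<in> T" for s k
  proof -
    obtain r where "s = foldr (\<lambda>k s. s @ [g s k]) r []"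
      using s unfolding T_def by blast
    then show ?thesis
      unfolding T_def by (intro range_eqI[of _ _ "k # r"]) simp
  qed
  have T_legal: "set s \<subseteq> \<A>" if "s \<in> T" for s
  proof -
    have "set (foldr (\<lambda>k s. s @ [g s k]) r []) \<subseteq> \<A>" for r
      by (induction r) (auto simp: Wg(2))
    with that show ?thesis unfolding T_def by blast
  qed
  show thesis
  proof
    show "W ` T \<subseteq> \<W>"
      using Wg(1) T_legal by blast
    show "countable (W ` T)"
      by (simp add: T_def)
    show "X \<subseteq> \<Union>(W ` T)"
    proof (rule ccontr)
      assume "\<not> ?thesis"
      then obtain x where x: "x \<in> X" "\<And>s. s \<in> T \<Longrightarrow> x \<notin> W s"
        by blast
      \<comment> \<open>Since \<open>x\<close> is not in \<open>W s\<close>, some move available at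
        \<open>s\<close> draws an answer that misses \<open>x\<close>; \<open>h\<close> picks its
        index.\<close>
      have "\<exists>k. x \<notin> \<Union>(\<sigma> (s @ [g s k]))" if "s \<in> T" for s
        using Wg(3)[OF T_legal[OF that]] x(1) x(2)[OF that] by blast
      then obtain h where h: "\<And>s. s \<in> T \<Longrightarrow> x \<notin> \<Union>(\<sigma> (s @ [g s (h s)]))"
        by metis
      \<comment> \<open>\<open>P\<close> follows the branch chosen by \<open>h\<close> from the
        root, and \<open>\<U>\<close> lists Alice's moves along it.\<close>
      define P where "P n = ((\<lambda>s. s @ [g s (h s)]) ^^ n) []" for n
      define \<U> where "\<U> n = g (P n) (h (P n))" for n
      have P_Suc: "P (Suc n) = P n @ [\<U> n]" for n
        by (simp add: P_def \<U>_def)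
      have P_T: "P n \<in> T" for n
        by (induction n) (auto simp: P_def T_Nil T_snoc)
      \<comment> \<open>The nodes of the branch are the initial segments of one infinite play, so
        Bob's win along it applies and contradicts the choice of \<open>h\<close>.\<close>
      have P_eq: "P n = map \<U> [0..<n]" for n
      proof (induction n)
        case (Suc n)
        then show ?case by (simp add: P_Suc)
      qed (simp add: P_def)
      have "\<U> n \<in> \<A>" for n
        using Wg(2) T_legal[OF P_T] by (simp add: \<U>_def)
      then have "(\<Union>n. \<sigma> (map \<U> [0..<Suc n])) \<in> set_covers X"
        using \<sigma> unfolding gfin_winning_strategy_def by blast
      then obtain n where "x \<in> \<Union>(\<sigma> (map \<U> [0..<Suc n]))"
        using x(1) unfolding set_covers_def by blast
      then have "x \<in> \<Union>(\<sigma> (P n @ [g (P n) (h (P n))]))"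
        using P_eq[of "Suc n"] P_Suc[of n] by (simp add: \<U>_def)
      with h[OF P_T] show False by blast
    qed
  qed
qed

theorem theorem4p4:
  fixes X :: "'a set" and L :: "'a filter \<Rightarrow> 'a set" and \<W> :: "'a set set"
  assumes "convergence_space X L"
    and "regular_convergence X L"
    and "bob_wins_gfin (conv_covers X L) (set_covers X)"
    and "\<W> \<in> set_covers X"
    and "\<And>W. W \<in> \<W> \<Longrightarrow> gdelta_in (top_modification X L) W"
    and "\<And>K. compactoid X L K \<Longrightarrow> \<exists>W \<in> \<W>. K \<subseteq> W"
  shows "\<exists>\<V>. \<V> \<subseteq> \<W> \<and> countable \<V> \<and> \<V> \<in> set_covers X"
proof -
  note cs = assms(1) and reg = assms(2)
  obtain \<sigma> where \<sigma>: "gfin_winning_strategy (conv_covers X L) (set_covers X) \<sigma>"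
    using assms(3) by (auto simp: bob_wins_gfin_def)
  have "\<exists>W\<in>\<W>. \<exists>C\<subseteq>conv_covers X L. C \<noteq> {} \<and> countable C \<and>
      X \<inter> (\<Inter>\<U>\<in>C. \<Union>(\<sigma> (s @ [\<U>]))) \<subseteq> W"
    if s: "set s \<subseteq> conv_covers X L" for s
  proof -
    have "compactoid X L (\<Inter>\<U>\<in>conv_covers X L. conv_closure X L (\<Union>(\<sigma> (s @ [\<U>]))))"
      by (rule compactoid_INT_closure_finite_selection[OF cs reg])
        (rule gfin_winning_strategy_legal[OF \<sigma> s])
    then obtain W where W: "W \<in> \<W>"
        "(\<Inter>\<U>\<in>conv_covers X L. conv_closure X L (\<Union>(\<sigma> (s @ [\<U>])))) \<subseteq> W"
      using assms(6) by blast
    obtain C where C: "C \<subseteq> conv_covers X L" "countable C" "X \<inter> (\<Inter>\<U>\<in>C. \<Union>(\<sigma> (s @ [\<U>]))) \<subseteq> W"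
      using countable_INT_subset_gdelta[OF cs \<sigma> assms(5)[OF W(1)] W(2)] by metis
    \<comment> \<open>Adding the cover \<open>Pow X\<close> makes \<open>C\<close> nonempty and can
      only shrink the intersection.\<close>
    have "insert (Pow X) C \<subseteq> conv_covers X L" "countable (insert (Pow X) C)"
        "X \<inter> (\<Inter>\<U>\<in>insert (Pow X) C. \<Union>(\<sigma> (s @ [\<U>]))) \<subseteq> W"
      using C Pow_in_conv_covers by auto
    with W(1) show ?thesis by blast
  qed
  then obtain \<V> where \<V>: "\<V> \<subseteq> \<W>" "countable \<V>" "X \<subseteq> \<Union>\<V>"
    using gfin_winning_strategy_countable_tree[OF \<sigma>] by metis
  moreover have "\<V> \<in> set_covers X"
    using \<V> assms(4) unfolding set_covers_def by blast
  ultimately show ?thesis by blast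
qed

end
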